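(* Let $h_{\bm a,b}$ be a linear classifier on $\mathbb{R}^p$. Let $q_{RCF}$ be a robust counterfactual mechanism using an arbitrary differentiable norm $f(\bm x)=\|\bm x\|_{N_1}$ and robustness set $\mathcal{S}=\{\bm s\mid\|\bm s\|_{N_2}\le\rho\}$, where $\|\cdot\|_{N_2}$ is an arbitrary norm and $\rho>0$. Then one robust counterfactual query and one factual query for an arbitrary data point $\bm x_F\in\mathbb{R}^p$ suffice to extract the original model's parameters. In particular, for $q_{RCF}(\bm x_F)=\bm x_{RCF}^*$, let $$\hat{\bm a}=\nabla f(\bm x_{RCF}^*-\bm x_F),\qquad \hat b=\hat{\bm a}^\top\bm x_{RCF}^*+q_F(\bm x_F)\,\rho\,\|\hat{\bm a}\|_{N_2}^*.$$ Then the hyperplane given by $(\hat{\bm a},\hat b)$ is equivalent to the original hyperplane with parameters $(\bm a,b)$.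
   Context: A linear classifier with parameters $\bm a\in\mathbb{R}^p\setminus\{\bm 0\}$, $b\in\mathbb{R}$ is $h_{\bm a,b}:\mathbb{R}^p\to\{-1,1\}$ with $h_{\bm a,b}(\bm x)=1$ if $\bm a^\top\bm x-b\ge 0$ and $-1$ otherwise. The factual query is $q_F(\bm x):=h_{\bm a,b}(\bm x)\in\{-1,1\}$. Hyperplanes $(\bm a,b)$ and $(\hat{\bm a},\hat b)$ are equivalent if for all $\bm x$: $\hat{\bm a}^\top\bm x-\hat b=0\iff\bm a^\top\bm x-b=0$. A norm is called differentiable if it is differentiable at every $\bm x\in\mathbb{R}^p\setminus\{\bm 0\}$. $\|\cdot\|_{N}^*$ denotes the dual norm, $\|\bm a\|_N^*=\max_{\|\bm v\|_N\le 1}\bm a^\top\bm v$. A robust counterfactual query $q_{RCF}$ maps $\bm x$ to an optimal robust counterfactual: a point $\bm x_{RCF}$ minimizing $\|\bm x_{RCF}-\bm x\|_{N_1}$ subject to $\bm x_{RCF}+\bm s$ having the opposite class to $\bm x$ for all $\bm s\in\mathcal{S}$. By convention the closure of the class regions is used: the constraint is $\bm a^\top(\bm x_{RCF}+\bm s)\ge b\ \forall\bm s\in\mathcal{S}$ if $h_{\bm a,b}(\bm x)=-1$, and $\bm a^\top(\bm x_{RCF}+\bm s)\le b\ \forall\bm s\in\mathcal{S}$ if $h_{\bm a,b}(\bm x)=1$.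
   Formalization: The printed formula fails when q_F(x_F)=1 (p=1, a=1, b=0, ρ=1, x_F=1 gives x=-2, not x=0); proved instead: b̂ = âᵀx* - ρ‖â‖* with â = ∇f(x*-x_F), and also the printed b̂ with â = -q_F(x_F)∇f(x*-x_F); both agree with the print when q_F = -1. *)

theory Defs
  imports "HOL-Analysis.Analysis"
begin

definition is_norm :: "(real^'p \<Rightarrow> real) \<Rightarrow> bool" where
  "is_norm N \<longleftrightarrow>
     (\<forall>x. 0 \<le> N x) \<and>
     (\<forall>x. N x = 0 \<longleftrightarrow> x = 0) \<and>
     (\<forall>c x. N (c *\<^sub>R x) = \<bar>c\<bar> * N x) \<and>
     (\<forall>x y. N (x + y) \<le> N x + N y)"

definition differentiable_norm :: "(real^'p \<Rightarrow> real) \<Rightarrow> bool" where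
  "differentiable_norm N \<longleftrightarrow> is_norm N \<and> (\<forall>x. x \<noteq> 0 \<longrightarrow> N differentiable (at x))"

(* The unit ball of a norm on a finite-dimensional space is compact, so the supremum is a maximum. *)
definition dual_norm :: "(real^'p \<Rightarrow> real) \<Rightarrow> real^'p \<Rightarrow> real" where
  "dual_norm N a = (SUP v\<in>{v. N v \<le> 1}. a \<bullet> v)"

(* Meaningful only where f is differentiable; the gradient is then unique. *)
definition grad :: "(real^'p \<Rightarrow> real) \<Rightarrow> real^'p \<Rightarrow> real^'p" where
  "grad f x = (THE D. GDERIV f x :> D)"

definition classifier :: "real^'p \<Rightarrow> real \<Rightarrow> real^'p \<Rightarrow> real" where
  "classifier a b x = (if a \<bullet> x - b \<ge> 0 then 1 else - 1)"

definition hyperplane_equiv :: "real^'p \<Rightarrow> real \<Rightarrow> real^'p \<Rightarrow> real \<Rightarrow> bool" where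
  "hyperplane_equiv a' b' a b \<longleftrightarrow> (\<forall>x. a' \<bullet> x - b' = 0 \<longleftrightarrow> a \<bullet> x - b = 0)"

(* The point y + s is only required to lie in the closure of the opposite class of x;
   without the closure the minimum need not be attained. *)
definition robust_counterfactual ::
    "(real^'p) set \<Rightarrow> real^'p \<Rightarrow> real \<Rightarrow> real^'p \<Rightarrow> real^'p \<Rightarrow> bool" where
  "robust_counterfactual S a b x y \<longleftrightarrow>
     (if classifier a b x = - 1 then \<forall>s\<in>S. a \<bullet> (y + s) \<ge> b else \<forall>s\<in>S. a \<bullet> (y + s) \<le> b)"

definition optimal_robust_counterfactual ::
    "(real^'p \<Rightarrow> real) \<Rightarrow> (real^'p) set \<Rightarrow> real^'p \<Rightarrow> real \<Rightarrow> real^'p \<Rightarrow> real^'p \<Rightarrow> bool" where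
  "optimal_robust_counterfactual N S a b x y \<longleftrightarrow>
     robust_counterfactual S a b x y \<and>
     (\<forall>z. robust_counterfactual S a b x z \<longrightarrow> N (y - x) \<le> N (z - x))"

(* Optimal points need not be unique; a mechanism returns an arbitrary one. *)
definition rcf_mechanism ::
    "(real^'p \<Rightarrow> real) \<Rightarrow> (real^'p) set \<Rightarrow> real^'p \<Rightarrow> real \<Rightarrow> (real^'p \<Rightarrow> real^'p) \<Rightarrow> bool" where
  "rcf_mechanism N S a b q \<longleftrightarrow> (\<forall>x. optimal_robust_counterfactual N S a b x (q x))"

end

theory Submission
  imports Defs
begin

text \<open>
  The robust constraint over the ball of radius \<^term>\<open>\<rho>\<close> is the half-space obtained by shifting
  the original one by \<^term>\<open>\<rho> * dual_norm N2 a\<close>; the supremum in the dual norm is finite because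
  \<^term>\<open>N2\<close> is bounded below on the Euclidean unit sphere. The optimal robust counterfactual is thus a nearest point of a
  half-space not containing the factual point. It lies on the bounding hyperplane, and minimality
  along that hyperplane makes the gradient of the distance a multiple of the normal vector, with a
  positive factor by Euler's identity. The shift is then undone with the homogeneity of the dual norm.
\<close>

section \<open>Norms and their comparison with the Euclidean norm\<close>

lemma is_norm_nonneg: "is_norm N \<Longrightarrow> 0 \<le> N x"
  and is_norm_eq_0_iff: "is_norm N \<Longrightarrow> N x = 0 \<longleftrightarrow> x = 0"
  and is_norm_scaleR: "is_norm N \<Longrightarrow> N (c *\<^sub>R x) = \<bar>c\<bar> * N x"
  and is_norm_triangle: "is_norm N \<Longrightarrow> N (x + y) \<le> N x + N y"
  by (simp_all add: is_norm_def)

lemma is_norm_pos: "is_norm N \<Longrightarrow> x \<noteq> 0 \<Longrightarrow> 0 < N x"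
  using is_norm_nonneg[of N x] is_norm_eq_0_iff[of N x] by linarith

lemma is_norm_minus: "is_norm N \<Longrightarrow> N (- x) = N x"
  using is_norm_scaleR[of N "- 1" x] by simp

lemma convex_on_is_norm:
  assumes "is_norm N"
  shows "convex_on UNIV N"
proof (rule convex_onI)
  fix t :: real and x y
  assume "0 < t" "t < 1"
  then show "N ((1 - t) *\<^sub>R x + t *\<^sub>R y) \<le> (1 - t) * N x + t * N y"
    using is_norm_triangle[OF assms, of "(1 - t) *\<^sub>R x" "t *\<^sub>R y"]
    by (simp add: is_norm_scaleR[OF assms])
qed simp

text \<open>One half of the equivalence of norms in finite dimension: the minimum of
  \<open>N\<close> over the compact Euclidean unit sphere serves as \<open>c\<close>, and
  homogeneity does the rest.\<close>

lemma is_norm_ge_norm: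
  fixes N :: "real^'p \<Rightarrow> real"
  assumes "is_norm N"
  obtains c where "c > 0" "\<And>x. c * norm x \<le> N x"
proof -
  \<comment> \<open>A real convex function on all of a finite-dimensional space is
    continuous.\<close>
  have "continuous_on (sphere 0 1) N"
    using convex_on_continuous[OF open_UNIV convex_on_is_norm[OF assms]]
    by (rule continuous_on_subset) simp
  moreover have "axis undefined 1 \<in> (sphere 0 1 :: (real^'p) set)"
    by simp
  ultimately obtain u where u: "u \<in> sphere 0 1" "\<And>v. v \<in> sphere 0 1 \<Longrightarrow> N u \<le> N v"
    using continuous_attains_inf[of "sphere 0 1 :: (real^'p) set" N] by (metis compact_sphere empty_iff)
  have "N u * norm x \<le> N x" for x
  proof (cases "x = 0")
    case False
    then have "N u \<le> N ((1 / norm x) *\<^sub>R x)"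
      by (intro u(2)) simp
    then show ?thesis
      using False by (simp add: is_norm_scaleR[OF assms] field_simps)
  qed (simp add: is_norm_nonneg[OF assms])
  moreover have "N u > 0"
    using u(1) by (intro is_norm_pos[OF assms]) auto
  ultimately show ?thesis
    using that by blast
qed

section \<open>Dual norms\<close>

lemma bdd_above_dual_norm:
  fixes N :: "real^'p \<Rightarrow> real"
  assumes "is_norm N"
  shows "bdd_above ((\<lambda>v. a \<bullet> v) ` {v. N v \<le> 1})"
proof -
  obtain c where c: "c > 0" "\<And>x. c * norm x \<le> N x"
    using is_norm_ge_norm[OF assms] by blast
  have "a \<bullet> v \<le> norm a * (1 / c)" if "N v \<le> 1" for v
  proof -
    have "norm v \<le> 1 / c"
      using c(1) c(2)[of v] that by (simp add: field_simps)
    then have "norm a * norm v \<le> norm a * (1 / c)"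
      by (rule mult_left_mono) simp
    then show ?thesis
      using norm_cauchy_schwarz[of a v] by linarith
  qed
  then show ?thesis
    by (auto intro!: bdd_aboveI)
qed

text \<open>The least-upper-bound property, rescaled from the unit ball to radius \<open>r\<close>.
  It stands in for all reasoning about maximisers below.\<close>

lemma dual_norm_le_iff:
  fixes N :: "real^'p \<Rightarrow> real"
  assumes "is_norm N" "r > 0"
  shows "r * dual_norm N a \<le> k \<longleftrightarrow> (\<forall>s. N s \<le> r \<longrightarrow> a \<bullet> s \<le> k)"
proof -
  have "N 0 \<le> 1"
    using is_norm_eq_0_iff[OF assms(1), of 0] by simp
  then have "dual_norm N a \<le> k / r \<longleftrightarrow> (\<forall>v\<in>{v. N v \<le> 1}. a \<bullet> v \<le> k / r)"
    unfolding dual_norm_def by (intro cSUP_le_iff bdd_above_dual_norm[OF assms(1)]) auto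
  also have "\<dots> \<longleftrightarrow> (\<forall>s. N s \<le> r \<longrightarrow> a \<bullet> s \<le> k)"
  proof (intro iffI allI impI ballI)
    fix s assume *: "\<forall>v\<in>{v. N v \<le> 1}. a \<bullet> v \<le> k / r" and "N s \<le> r"
    then have "a \<bullet> ((1 / r) *\<^sub>R s) \<le> k / r"
      using assms(2) by (intro *[rule_format]) (simp add: is_norm_scaleR[OF assms(1)])
    then show "a \<bullet> s \<le> k"
      using assms(2) by (simp add: divide_le_cancel)
  next
    fix v assume *: "\<forall>s. N s \<le> r \<longrightarrow> a \<bullet> s \<le> k" and "v \<in> {v. N v \<le> 1}"
    then have "a \<bullet> (r *\<^sub>R v) \<le> k"
      using assms(2) by (intro *[rule_format]) (simp add: is_norm_scaleR[OF assms(1)])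
    then show "a \<bullet> v \<le> k / r"
      using assms(2) by (simp add: field_simps)
  qed
  finally show ?thesis
    using assms(2) by (simp add: field_simps)
qed

lemma dual_norm_minus:
  fixes N :: "real^'p \<Rightarrow> real"
  assumes "is_norm N"
  shows "dual_norm N (- a) = dual_norm N a"
proof -
  have "dual_norm N (- a) \<le> dual_norm N a" for a
  proof -
    have "- a \<bullet> s \<le> dual_norm N a" if "N s \<le> 1" for s
      using dual_norm_le_iff[OF assms, of 1 a "dual_norm N a", simplified, rule_format, of "- s"] that
      by (simp add: is_norm_minus[OF assms])
    then show ?thesis
      using dual_norm_le_iff[OF assms, of 1 "- a" "dual_norm N a"] by simp
  qed
  from this[of a] this[of "- a"] show ?thesis
    by simp
qed

lemma dual_norm_scaleR_pos:
  fixes N :: "real^'p \<Rightarrow> real"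
  assumes "is_norm N" "c > 0"
  shows "dual_norm N (c *\<^sub>R a) = c * dual_norm N a"
proof -
  \<comment> \<open>Two reals with the same upper bounds \<open>k\<close> are equal.\<close>
  have "dual_norm N (c *\<^sub>R a) \<le> k \<longleftrightarrow> c * dual_norm N a \<le> k" for k
  proof -
    have "dual_norm N (c *\<^sub>R a) \<le> k \<longleftrightarrow> (\<forall>s. N s \<le> 1 \<longrightarrow> a \<bullet> s \<le> k / c)"
      using dual_norm_le_iff[OF assms(1), of 1 "c *\<^sub>R a" k] assms(2) by (simp add: field_simps)
    also have "\<dots> \<longleftrightarrow> dual_norm N a \<le> k / c"
      using dual_norm_le_iff[OF assms(1), of 1 a "k / c"] by simp
    finally show ?thesis
      using assms(2) by (simp add: field_simps)
  qed
  then show ?thesis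
    by (meson order.antisym order.refl)
qed

lemma dual_norm_pos:
  fixes N :: "real^'p \<Rightarrow> real"
  assumes "is_norm N" "a \<noteq> 0"
  shows "dual_norm N a > 0"
proof -
  have "0 < N a"
    using assms by (rule is_norm_pos)
  \<comment> \<open>The test vector is \<open>a\<close> itself, in the ball of radius
    \<open>N a\<close>.\<close>
  then have "a \<bullet> a \<le> N a * dual_norm N a"
    using dual_norm_le_iff[OF assms(1), of "N a" a "N a * dual_norm N a"] by simp
  moreover have "0 < a \<bullet> a"
    using assms(2) by simp
  ultimately have "0 < N a * dual_norm N a"
    by linarith
  then show ?thesis
    using \<open>0 < N a\<close> by (simp add: zero_less_mult_iff)
qed

section \<open>Gradients of norms\<close>

lemma GDERIV_grad:
  fixes f :: "real^'p \<Rightarrow> real"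
  assumes "f differentiable (at x)"
  shows "GDERIV f x :> grad f x"
proof -
  obtain f' where f': "(f has_derivative f') (at x)"
    using assms by (auto simp: differentiable_def)
  \<comment> \<open>Riesz representation of the linear functional \<open>f'\<close>.\<close>
  have "f' = (\<lambda>h. h \<bullet> adjoint f' 1)"
    using adjoint_works[OF has_derivative_linear[OF f'], of _ 1] by auto
  then have D: "GDERIV f x :> adjoint f' 1"
    using f' by (simp add: gderiv_def)
  \<comment> \<open>Uniqueness discharges the definite description in \<open>grad\<close>.\<close>
  have "D' = adjoint f' 1" if "GDERIV f x :> D'" for D'
  proof -
    have "(\<lambda>h. h \<bullet> D') = (\<lambda>h. h \<bullet> adjoint f' 1)"
      using that D unfolding gderiv_def by (rule has_derivative_unique)
    then show ?thesis
      by (metis inner_commute vector_eq_rdot)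
  qed
  with D show ?thesis
    unfolding grad_def by (rule theI)
qed

lemma DERIV_along_line:
  assumes "GDERIV f x :> D"
  shows "((\<lambda>t. f (x + t *\<^sub>R v)) has_real_derivative v \<bullet> D) (at 0)"
proof -
  have "(f has_derivative (\<lambda>h. h \<bullet> D)) (at (x + 0 *\<^sub>R v))"
    using assms by (simp add: gderiv_def)
  moreover have "((\<lambda>t. x + t *\<^sub>R v) has_derivative (\<lambda>t. t *\<^sub>R v)) (at 0)"
    by (auto intro!: derivative_eq_intros)
  ultimately have "((\<lambda>t. f (x + t *\<^sub>R v)) has_derivative (\<lambda>t. (t *\<^sub>R v) \<bullet> D)) (at 0)"
    by (rule has_derivative_compose[rotated])
  moreover have "(\<lambda>t. (t *\<^sub>R v) \<bullet> D) = (*) (v \<bullet> D)"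
    by auto
  ultimately show ?thesis
    by (simp add: has_field_derivative_def)
qed

text \<open>Euler's identity for degree one: along its own ray, \<open>N\<close> grows linearly with
  slope \<open>N d\<close>.\<close>

lemma inner_grad_is_norm:
  fixes N :: "real^'p \<Rightarrow> real"
  assumes "is_norm N" "GDERIV N d :> D"
  shows "d \<bullet> D = N d"
proof -
  have "((\<lambda>t. (1 + t) * N d) has_real_derivative N d) (at 0)"
    by (auto intro!: derivative_eq_intros)
  then have "((\<lambda>t. N (d + t *\<^sub>R d)) has_real_derivative N d) (at 0)"
  \<comment> \<open>Radius 1 keeps \<open>1 + t\<close> positive, so homogeneity applies without the
    absolute value.\<close>
  proof (rule has_field_derivative_transform_within[where d = 1])
    show "(1 + t) * N d = N (d + t *\<^sub>R d)" if "dist t 0 < 1" for t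
      using is_norm_scaleR[OF assms(1), of "1 + t" d] that
      by (simp add: dist_real_def scaleR_add_left abs_if split: if_splits)
  qed auto
  with DERIV_along_line[OF assms(2)] show ?thesis
    by (rule DERIV_unique)
qed

text \<open>The Lagrange condition for one linear constraint, with multiplier \<open>l\<close>. As
  \<open>x\<close> violates the constraint strictly, \<open>y - x\<close> is nonzero and the
  gradient exists there.\<close>

lemma nearest_point_halfspace:
  fixes N :: "real^'p \<Rightarrow> real"
  assumes N: "differentiable_norm N"
    and x: "\<alpha> \<bullet> x < c" and y: "c \<le> \<alpha> \<bullet> y"
    and min: "\<And>z. c \<le> \<alpha> \<bullet> z \<Longrightarrow> N (y - x) \<le> N (z - x)"
  obtains l where "l > 0" "grad N (y - x) = l *\<^sub>R \<alpha>" "\<alpha> \<bullet> y = c"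
proof -
  define d where "d = y - x"
  define g where "g = grad N d"
  \<comment> \<open>The coefficient of the orthogonal projection of \<open>g\<close> onto the line
    spanned by \<open>\<alpha>\<close>.\<close>
  define l where "l = (g \<bullet> \<alpha>) / (\<alpha> \<bullet> \<alpha>)"
  have norm: "is_norm N"
    using N by (simp add: differentiable_norm_def)
  have ad: "0 < \<alpha> \<bullet> d"
    using x y by (simp add: d_def inner_diff_right)
  then have "d \<noteq> 0" "\<alpha> \<noteq> 0"
    by auto
  then have g: "GDERIV N d :> g"
    using N unfolding g_def differentiable_norm_def by (blast intro: GDERIV_grad)
  have Nd: "0 < N d"
    using norm \<open>d \<noteq> 0\<close> by (rule is_norm_pos)
  have active: "\<alpha> \<bullet> y = c"
  proof (rule ccontr)
    assume "\<alpha> \<bullet> y \<noteq> c"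
    \<comment> \<open>If the constraint were slack, going back from \<open>y\<close> towards
      \<open>x\<close> by the fraction \<open>t\<close> would end on the bounding hyperplane,
      strictly closer to \<open>x\<close>.\<close>
    define t where "t = (\<alpha> \<bullet> y - c) / (\<alpha> \<bullet> d)"
    have t: "0 < t" "t \<le> 1"
      using \<open>\<alpha> \<bullet> y \<noteq> c\<close> x y ad by (auto simp: t_def d_def inner_diff_right field_simps)
    have "t * (\<alpha> \<bullet> d) = \<alpha> \<bullet> y - c"
      using ad by (simp add: t_def)
    then have "N d \<le> N (y - t *\<^sub>R d - x)"
      unfolding d_def[symmetric] using min[of "y - t *\<^sub>R d"]
      by (simp add: inner_diff_right d_def)
    also have "y - t *\<^sub>R d - x = (1 - t) *\<^sub>R d"
      by (simp add: d_def algebra_simps)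
    also have "N \<dots> = (1 - t) * N d"
      using t by (simp add: is_norm_scaleR[OF norm])
    finally show False
      using mult_pos_pos[OF t(1) Nd] by (simp add: algebra_simps)
  qed
  \<comment> \<open>Moving along the hyperplane stays feasible for either sign of \<open>t\<close>,
    so \<open>t = 0\<close> is a local minimum and the directional derivative vanishes.\<close>
  have orth: "v \<bullet> g = 0" if "\<alpha> \<bullet> v = 0" for v
  proof (rule DERIV_local_min[OF DERIV_along_line[OF g] zero_less_one], intro allI impI)
    fix t :: real
    show "N (d + 0 *\<^sub>R v) \<le> N (d + t *\<^sub>R v)"
      using min[of "y + t *\<^sub>R v"] that y by (simp add: d_def inner_add_right algebra_simps)
  qed
  \<comment> \<open>The residual of the projection is orthogonal to \<open>\<alpha>\<close>, hence
    to \<open>g\<close> by \<open>orth\<close>, hence to itself.\<close>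
  have "\<alpha> \<bullet> (g - l *\<^sub>R \<alpha>) = 0"
    using \<open>\<alpha> \<noteq> 0\<close> by (simp add: l_def inner_diff_right inner_commute)
  moreover from this have "(g - l *\<^sub>R \<alpha>) \<bullet> g = 0"
    by (rule orth)
  ultimately have "(g - l *\<^sub>R \<alpha>) \<bullet> (g - l *\<^sub>R \<alpha>) = 0"
    by (simp add: inner_diff_right inner_commute)
  then have gl: "g = l *\<^sub>R \<alpha>"
    by simp
  have "0 < l * (\<alpha> \<bullet> d)"
    using inner_grad_is_norm[OF norm g] Nd gl by (simp add: inner_commute)
  then have "0 < l"
    using ad by (simp add: zero_less_mult_iff)
  then show ?thesis
    using that gl active by (simp add: g_def d_def)
qed

section \<open>The robust constraint as a shifted half-space\<close>

lemma robust_counterfactual_ball_iff: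
  fixes N :: "real^'p \<Rightarrow> real" and a x y :: "real^'p" and b \<rho> :: real
  assumes "is_norm N" "\<rho> > 0"
  defines "\<sigma> \<equiv> - classifier a b x"
  shows "robust_counterfactual {s. N s \<le> \<rho>} a b x y \<longleftrightarrow>
    \<sigma> * b + \<rho> * dual_norm N a \<le> (\<sigma> *\<^sub>R a) \<bullet> y"
\<comment> \<open>The sign \<open>\<sigma>\<close> of the opposite class turns both constraints into
  lower bounds on \<open>(\<sigma> *\<^sub>R a) \<bullet> y\<close>.\<close>
proof (cases "classifier a b x = - 1")
  case True
  have "robust_counterfactual {s. N s \<le> \<rho>} a b x y \<longleftrightarrow> (\<forall>s. N s \<le> \<rho> \<longrightarrow> b \<le> a \<bullet> (y + s))"
    using True by (simp add: robust_counterfactual_def)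
  \<comment> \<open>Here the worst perturbation maximises \<open>- a \<bullet> s\<close>; symmetry
    of the dual norm then removes the sign.\<close>
  also have "\<dots> \<longleftrightarrow> (\<forall>s. N s \<le> \<rho> \<longrightarrow> - a \<bullet> s \<le> a \<bullet> y - b)"
    by (simp add: inner_add_right algebra_simps)
  also have "\<dots> \<longleftrightarrow> \<rho> * dual_norm N a \<le> a \<bullet> y - b"
    using dual_norm_le_iff[OF assms(1,2), of "- a"] by (simp add: dual_norm_minus[OF assms(1)])
  finally show ?thesis
    using True by (simp add: \<sigma>_def algebra_simps)
next
  case False
  then have *: "classifier a b x = 1"
    by (simp add: classifier_def split: if_splits)
  have "robust_counterfactual {s. N s \<le> \<rho>} a b x y \<longleftrightarrow> (\<forall>s. N s \<le> \<rho> \<longrightarrow> a \<bullet> (y + s) \<le> b)"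
    using * by (simp add: robust_counterfactual_def)
  also have "\<dots> \<longleftrightarrow> (\<forall>s. N s \<le> \<rho> \<longrightarrow> a \<bullet> s \<le> b - a \<bullet> y)"
    by (simp add: inner_add_right algebra_simps)
  also have "\<dots> \<longleftrightarrow> \<rho> * dual_norm N a \<le> b - a \<bullet> y"
    using dual_norm_le_iff[OF assms(1,2), of a] by simp
  finally show ?thesis
    using * by (simp add: \<sigma>_def algebra_simps)
qed

lemma hyperplane_equiv_scaleR:
  "k \<noteq> 0 \<Longrightarrow> hyperplane_equiv (k *\<^sub>R a) (k * b) a b"
  by (simp add: hyperplane_equiv_def)

text \<open>The gradient points into the opposite class, so subtracting the robustness margin leads
  back to the original hyperplane for either class of \<open>x\<close>. Only the sign of
  \<open>k\<close> depends on the class.\<close>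

lemma grad_optimal_robust_counterfactual:
  fixes N1 N2 :: "real^'p \<Rightarrow> real"
  assumes N1: "differentiable_norm N1" and N2: "is_norm N2" and "\<rho> > 0" "a \<noteq> 0"
    and opt: "optimal_robust_counterfactual N1 {s. N2 s \<le> \<rho>} a b x y"
  obtains k where "k \<noteq> 0" "grad N1 (y - x) = k *\<^sub>R a"
    "grad N1 (y - x) \<bullet> y - \<rho> * dual_norm N2 (grad N1 (y - x)) = k * b"
proof -
  define \<sigma> where "\<sigma> = - classifier a b x"
  define c where "c = \<sigma> * b + \<rho> * dual_norm N2 a"
  note rc = robust_counterfactual_ball_iff[OF N2 \<open>\<rho> > 0\<close>, of a b x, folded \<sigma>_def c_def]
  have \<sigma>: "\<sigma> = 1 \<or> \<sigma> = - 1"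
    by (simp add: \<sigma>_def classifier_def)
  have D: "dual_norm N2 (\<sigma> *\<^sub>R a) = dual_norm N2 a"
    using \<sigma> by (auto simp: dual_norm_minus[OF N2])
  \<comment> \<open>The positive shift makes \<open>x\<close> strictly infeasible even when it lies
    on the decision hyperplane.\<close>
  have "0 < \<rho> * dual_norm N2 a"
    using \<open>\<rho> > 0\<close> dual_norm_pos[OF N2 \<open>a \<noteq> 0\<close>] by simp
  moreover have "(\<sigma> *\<^sub>R a) \<bullet> x \<le> \<sigma> * b"
    by (simp add: \<sigma>_def classifier_def)
  ultimately have "(\<sigma> *\<^sub>R a) \<bullet> x < c"
    by (simp add: c_def)
  moreover have "c \<le> (\<sigma> *\<^sub>R a) \<bullet> y"
    using opt rc by (simp add: optimal_robust_counterfactual_def)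
  moreover have "N1 (y - x) \<le> N1 (z - x)" if "c \<le> (\<sigma> *\<^sub>R a) \<bullet> z" for z
    using opt rc that by (simp add: optimal_robust_counterfactual_def)
  ultimately obtain l where l: "l > 0" "grad N1 (y - x) = l *\<^sub>R (\<sigma> *\<^sub>R a)" "(\<sigma> *\<^sub>R a) \<bullet> y = c"
    using nearest_point_halfspace[OF N1] by metis
  \<comment> \<open>The positive factor \<open>l\<close> leaves the dual norm, so the margin
    contained in \<open>c\<close> cancels and \<open>k = l * \<sigma>\<close> remains.\<close>
  have "grad N1 (y - x) \<bullet> y - \<rho> * dual_norm N2 (grad N1 (y - x)) = l * c - \<rho> * (l * dual_norm N2 a)"
    unfolding l(2) dual_norm_scaleR_pos[OF N2 l(1)] D using l(3) by simp
  also have "\<dots> = l * \<sigma> * b"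
    by (simp add: c_def algebra_simps)
  finally show ?thesis
    using that[of "l * \<sigma>"] l \<sigma> by auto
qed

text \<open>\<open>extract\<close> is chosen before the model and the mechanism, so it sees only the
  point and the two answers. The explicit formula has two sign conventions: the raw gradient is a
  positive multiple of \<open>- q *\<^sub>R a\<close> and takes the offset \<open>- \<rho>\<close>,
  while the offset \<open>q * \<rho>\<close> fits the gradient oriented by \<open>- q\<close>. For
  \<open>q = 1\<close>, the raw gradient with \<open>q * \<rho>\<close> would shift the wrong
  way.\<close>

theorem theorem17:
  fixes N1 N2 :: "real^'p \<Rightarrow> real" and \<rho> :: real
  assumes "differentiable_norm N1" and "is_norm N2" and "\<rho> > 0"
  shows
    "(\<exists>extract :: real^'p \<Rightarrow> real^'p \<Rightarrow> real \<Rightarrow> (real^'p) \<times> real.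
        \<forall>a b q_RCF x_F. a \<noteq> 0 \<longrightarrow> rcf_mechanism N1 {s. N2 s \<le> \<rho>} a b q_RCF \<longrightarrow>
          (case extract x_F (q_RCF x_F) (classifier a b x_F) of
             (a', b') \<Rightarrow> hyperplane_equiv a' b' a b)) \<and>
     (\<forall>a b q_RCF x_F. a \<noteq> 0 \<longrightarrow> rcf_mechanism N1 {s. N2 s \<le> \<rho>} a b q_RCF \<longrightarrow>
        (let x_RCF = q_RCF x_F;
             q = classifier a b x_F;
             g = grad N1 (x_RCF - x_F)
         in (let a' = g; b' = a' \<bullet> x_RCF - \<rho> * dual_norm N2 a'
             in hyperplane_equiv a' b' a b) \<and>
            (let a' = - q *\<^sub>R g; b' = a' \<bullet> x_RCF + q * \<rho> * dual_norm N2 a'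
             in hyperplane_equiv a' b' a b)))"
proof -
  define A where "A x y = grad N1 (y - x)" for x y
  define B where "B x y = A x y \<bullet> y - \<rho> * dual_norm N2 (A x y)" for x y
  have first: "hyperplane_equiv (A x (q x)) (B x (q x)) a b"
    and second: "hyperplane_equiv (- classifier a b x *\<^sub>R A x (q x))
      ((- classifier a b x *\<^sub>R A x (q x)) \<bullet> q x +
        classifier a b x * \<rho> * dual_norm N2 (- classifier a b x *\<^sub>R A x (q x))) a b"
    if "a \<noteq> 0" and mech: "rcf_mechanism N1 {s. N2 s \<le> \<rho>} a b q" for a b q x
  proof -
    obtain k where k: "k \<noteq> 0" "A x (q x) = k *\<^sub>R a" "B x (q x) = k * b"
      unfolding A_def B_def
      using grad_optimal_robust_counterfactual[OF assms \<open>a \<noteq> 0\<close>] mech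
      unfolding rcf_mechanism_def by metis
    then show "hyperplane_equiv (A x (q x)) (B x (q x)) a b"
      by (simp add: hyperplane_equiv_scaleR)
    define \<sigma> where "\<sigma> = - classifier a b x"
    have \<sigma>: "\<sigma> = 1 \<or> \<sigma> = - 1"
      by (simp add: \<sigma>_def classifier_def)
    have "\<sigma> *\<^sub>R A x (q x) = (\<sigma> * k) *\<^sub>R a"
      using k(2) by simp
    \<comment> \<open>The dual norm ignores the sign \<open>\<sigma>\<close>, so this is the
      equation for \<open>B\<close> multiplied by \<open>\<sigma>\<close>.\<close>
    moreover have "(\<sigma> *\<^sub>R A x (q x)) \<bullet> q x - \<sigma> * \<rho> * dual_norm N2 (\<sigma> *\<^sub>R A x (q x)) = (\<sigma> * k) * b"
      using \<sigma> k(3) by (auto simp: B_def dual_norm_minus[OF assms(2)])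
    ultimately have "hyperplane_equiv (\<sigma> *\<^sub>R A x (q x))
        ((\<sigma> *\<^sub>R A x (q x)) \<bullet> q x - \<sigma> * \<rho> * dual_norm N2 (\<sigma> *\<^sub>R A x (q x))) a b"
      using \<sigma> k(1) by (metis hyperplane_equiv_scaleR mult_eq_0_iff neg_equal_0_iff_equal zero_neq_one)
    then show "hyperplane_equiv (- classifier a b x *\<^sub>R A x (q x))
      ((- classifier a b x *\<^sub>R A x (q x)) \<bullet> q x +
        classifier a b x * \<rho> * dual_norm N2 (- classifier a b x *\<^sub>R A x (q x))) a b"
      by (simp add: \<sigma>_def)
  qed
  show ?thesis
  proof (intro conjI exI[of _ "\<lambda>x y _. (A x y, B x y)"] allI impI)
    show "case (A x (q x), B x (q x)) of (a', b') \<Rightarrow> hyperplane_equiv a' b' a b"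
      if "a \<noteq> 0" "rcf_mechanism N1 {s. N2 s \<le> \<rho>} a b q" for a b q x
      using first[OF that] by simp
  qed (use first second in \<open>unfold Let_def A_def B_def, blast\<close>)
qed

end
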